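(* Let $n\in\mathbb{N}$, $n\ge 1$, be arbitrary. Then for any $a_1,\dots,a_n\in\mathbb{R}$ and $b_1,\dots,b_n\in(0,\infty)$ the following inequality holds: $$\min\left\{\frac{a_1}{b_1},\dots,\frac{a_n}{b_n}\right\}\le\frac{a_1+\cdots+a_n}{b_1+\cdots+b_n}\le\max\left\{\frac{a_1}{b_1},\dots,\frac{a_n}{b_n}\right\}.$$ *)

theory Defs
  imports Complex_Main
begin

end

theory Submission
  imports Defs
begin

text \<open>
  The quotient of the sums is the weighted average of the quotients \<open>a i / b i\<close> with the
  positive weights \<open>b i\<close>, so it lies between their bounds: summing \<open>m * b i \<le> a i \<le> M * b i\<close>
  and dividing by the positive total weight proves both inequalities.
\<close>

theorem lemma1p7:
  fixes n :: nat and a b :: "nat \<Rightarrow> real"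
  assumes "n \<ge> 1"
    and "\<And>i. i \<in> {1..n} \<Longrightarrow> b i > 0"
  shows "Min ((\<lambda>i. a i / b i) ` {1..n}) \<le> (\<Sum>i=1..n. a i) / (\<Sum>i=1..n. b i)
    \<and> (\<Sum>i=1..n. a i) / (\<Sum>i=1..n. b i) \<le> Max ((\<lambda>i. a i / b i) ` {1..n})"
proof -
  define m where "m = Min ((\<lambda>i. a i / b i) ` {1..n})"
  define M where "M = Max ((\<lambda>i. a i / b i) ` {1..n})"
  have pos: "(\<Sum>i=1..n. b i) > 0"
    using assms by (intro sum_pos) auto
  have lower: "m * b i \<le> a i" if "i \<in> {1..n}" for i
  proof -
    have "m \<le> a i / b i"
      unfolding m_def using that by (intro Min_le) auto
    then show ?thesis
      using assms(2)[OF that] by (simp add: pos_le_divide_eq)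
  qed
  have upper: "a i \<le> M * b i" if "i \<in> {1..n}" for i
  proof -
    have "a i / b i \<le> M"
      unfolding M_def using that by (intro Max_ge) auto
    then show ?thesis
      using assms(2)[OF that] by (simp add: pos_divide_le_eq)
  qed
  have "m * (\<Sum>i=1..n. b i) \<le> (\<Sum>i=1..n. a i)"
    unfolding sum_distrib_left by (intro sum_mono lower)
  moreover have "(\<Sum>i=1..n. a i) \<le> M * (\<Sum>i=1..n. b i)"
    unfolding sum_distrib_left by (intro sum_mono upper)
  ultimately have "m \<le> (\<Sum>i=1..n. a i) / (\<Sum>i=1..n. b i)
      \<and> (\<Sum>i=1..n. a i) / (\<Sum>i=1..n. b i) \<le> M"
    using pos by (simp add: pos_le_divide_eq pos_divide_le_eq)
  then show ?thesis
    unfolding m_def M_def .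
qed

end
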